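(* Let $i,j,k,l$ be positive integers with $(i,j)\neq(k,l)$ and $i\ge k$. Then: (1) If $i=k$ and $j>l$: if $i=k=1$ then $\mathcal{G}_{\langle i,j\rangle}=\mathcal{G}_{\langle k,l\rangle}$, and if $i=k>1$ then $\mathcal{G}_{\langle k,l\rangle}\subsetneq\mathcal{G}_{\langle i,j\rangle}$. (2) If $i>k$ and $j>l$, then $\mathcal{G}_{\langle k,l\rangle}\subsetneq\mathcal{G}_{\langle i,j\rangle}$. (3) If $i>k$ and $j=l$, then $\mathcal{G}_{\langle k,l\rangle}\subsetneq\mathcal{G}_{\langle i,j\rangle}$. (4) If $i>k$ and $j<l$, then (a) $\mathcal{G}_{\langle k,l\rangle}\subsetneq\mathcal{G}_{\langle i,j\rangle}$ if $k=1$, and $\mathcal{G}_{\langle k,l\rangle}\not\subseteq\mathcal{G}_{\langle i,j\rangle}$ if $k>1$; (b) $\mathcal{G}_{\langle i,j\rangle}\not\subseteq\mathcal{G}_{\langle k,l\rangle}$ if $i>k^2-k+1$, or $(i-1)j>(k-1)l$, or $j\ge k\ge 2$.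
   Context: All digraphs are finite, without loops and without parallel arcs; all graphs are finite and simple. The competition graph of a digraph $D$ has vertex set $V(D)$ and an edge $uv$ ($u\ne v$) iff $u$ and $v$ have a common out-neighbor in $D$. For positive integers $i,j$, an $\langle i,j\rangle$ digraph is a loopless digraph in which every vertex has indegree at most $i$ and outdegree at most $j$ (not necessarily acyclic). An $\langle i,j\rangle$ competition graph is the competition graph of some $\langle i,j\rangle$ digraph, and $\mathcal{G}_{\langle i,j\rangle}$ denotes the family of all $\langle i,j\rangle$ competition graphs (up to isomorphism). *)

theory Defs
  imports "Graph_Theory.Graph_Theory"
begin

text \<open>
  A finite digraph without loops and without parallel arcs is a \<open>pair_digraph\<close>;
  a finite simple graph is a \<open>pair_graph\<close>, that is, an undirected edge \<open>uv\<close> is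
  represented by the two arcs \<open>(u, v)\<close> and \<open>(v, u)\<close>.
\<close>

definition competition_graph :: "'a pair_pre_digraph \<Rightarrow> 'a pair_pre_digraph" where
  "competition_graph D =
     \<lparr> pverts = pverts D,
       parcs = {(u, v). u \<in> pverts D \<and> v \<in> pverts D \<and> u \<noteq> v \<and>
                        (\<exists>w \<in> pverts D. (u, w) \<in> parcs D \<and> (v, w) \<in> parcs D)} \<rparr>"

definition ij_digraph :: "nat \<Rightarrow> nat \<Rightarrow> 'a pair_pre_digraph \<Rightarrow> bool" where
  "ij_digraph i j D \<longleftrightarrow>
     pair_digraph D \<and>
     (\<forall>v \<in> pverts D. in_degree (with_proj D) v \<le> i \<and> out_degree (with_proj D) v \<le> j)"

definition ij_competition_graph :: "nat \<Rightarrow> nat \<Rightarrow> 'a pair_pre_digraph \<Rightarrow> bool" where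
  "ij_competition_graph i j G \<longleftrightarrow>
     (\<exists>D :: 'a pair_pre_digraph.
        ij_digraph i j D \<and> digraph_iso (with_proj G) (with_proj (competition_graph D)))"

text \<open>
  The family of all \<open>\<langle>i,j\<rangle>\<close> competition graphs up to isomorphism. Every finite graph is
  isomorphic to one whose vertices are natural numbers, and membership is invariant under
  isomorphism, so inclusions between these sets of graphs on natural numbers are exactly the
  inclusions between the corresponding families of isomorphism classes.
\<close>

definition ij_family :: "nat \<Rightarrow> nat \<Rightarrow> nat pair_pre_digraph set" where
  "ij_family i j = {G. ij_competition_graph i j G}"

lemma pair_graph_competition_graph:
  assumes "pair_digraph D"
  shows "pair_graph (competition_graph D)"
proof -
  interpret pair_digraph D by (fact assms)
  have "parcs (competition_graph D) \<subseteq> pverts D \<times> pverts D"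
    by (auto simp: competition_graph_def)
  then have "finite (parcs (competition_graph D))"
    using pair_finite_verts by (meson finite_SigmaI finite_subset)
  then show ?thesis
    using pair_finite_verts
    by unfold_locales (auto simp: competition_graph_def symmetric_def intro!: symI)
qed

lemma ij_competition_graph_competition_graph:
  assumes "ij_digraph i j D"
  shows "ij_competition_graph i j (competition_graph D)"
proof -
  have "pair_digraph D" using assms by (simp add: ij_digraph_def)
  then interpret C: pair_graph "competition_graph D" by (rule pair_graph_competition_graph)
  let ?G = "with_proj (competition_graph D)"
  let ?id = "\<lparr> iso_verts = id, iso_arcs = id, iso_head = snd, iso_tail = fst \<rparr>"
  have "pre_digraph.digraph_isomorphism ?G ?id"
    using C.wf_digraph by (simp add: pre_digraph.digraph_isomorphism_def)
  moreover have "?G = app_iso ?id ?G"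
    by (simp add: app_iso_def with_proj_def)
  ultimately have "digraph_iso ?G ?G"
    unfolding digraph_iso_def by blast
  then show ?thesis
    using assms unfolding ij_competition_graph_def by blast
qed

end

theory Submission
  imports Defs
begin

text \<open>
  The in-neighbourhoods of an \<open>\<langle>i,j\<rangle>\<close> digraph on \<open>V\<close> are sets \<open>S w \<subseteq> V - {w}\<close> of size at most
  \<open>i\<close>, one for each \<open>w \<in> V\<close>, that cover each vertex at most \<open>j\<close> times, and they are exactly the
  cliques of which the competition graph is the union. Hence in an \<open>\<langle>i,j\<rangle>\<close> competition graph
  degrees are at most \<open>(i - 1) j\<close>, no vertex has more than \<open>j\<close> pairwise non-adjacent neighbours,
  and there are at most \<open>|V| i (i - 1)\<close> arcs. Windmills (cliques glued at one vertex) violate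
  the first bound, stars the second. The third is violated by the union of a large clique and a
  single isolated vertex, and by a partial linear space with lines of size \<open>k + 1\<close> in which
  almost all points lie on \<open>k\<close> lines.
\<close>

section \<open>Competition graphs as unions of cliques\<close>

definition clique_graph :: "'a set \<Rightarrow> ('a \<Rightarrow> 'a set) \<Rightarrow> 'a pair_pre_digraph" where
  "clique_graph V S =
     \<lparr> pverts = V, parcs = {(u, v). u \<noteq> v \<and> (\<exists>w \<in> V. u \<in> S w \<and> v \<in> S w)} \<rparr>"

definition ij_cliques :: "nat \<Rightarrow> nat \<Rightarrow> 'a set \<Rightarrow> ('a \<Rightarrow> 'a set) \<Rightarrow> bool" where
  "ij_cliques i j V S \<longleftrightarrow>
     finite V \<and>
     (\<forall>w \<in> V. S w \<subseteq> V - {w} \<and> card (S w) \<le> i) \<and>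
     (\<forall>v \<in> V. card {w \<in> V. v \<in> S w} \<le> j)"

lemma ij_cliquesD:
  assumes "ij_cliques i j V S"
  shows "finite V"
    and "w \<in> V \<Longrightarrow> S w \<subseteq> V - {w}"
    and "w \<in> V \<Longrightarrow> card (S w) \<le> i"
    and "w \<in> V \<Longrightarrow> finite (S w)"
    and "v \<in> V \<Longrightarrow> card {w \<in> V. v \<in> S w} \<le> j"
  using assms unfolding ij_cliques_def by (auto dest: finite_subset)

lemma ij_competition_graph_clique_graph:
  assumes "ij_cliques i j V S"
  shows "ij_competition_graph i j (clique_graph V S)"
proof -
  note S = ij_cliquesD[OF assms]
  define D where "D = \<lparr> pverts = V, parcs = {(u, w). w \<in> V \<and> u \<in> S w} \<rparr>"
  have sub: "u \<in> V" "u \<noteq> w" if "w \<in> V" "u \<in> S w" for u w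
    using S(2) that by auto
  then have arcs: "parcs D \<subseteq> V \<times> V"
    by (auto simp: D_def)
  have "finite (parcs D)"
    using arcs S(1) by (meson finite_SigmaI finite_subset)
  then have D: "pair_digraph D"
    using S(1) by unfold_locales (auto simp: D_def dest: sub)
  have "in_arcs (with_proj D) v = (\<lambda>u. (u, v)) ` S v" if "v \<in> V" for v
    using that by (auto simp: D_def in_arcs_def)
  then have "in_degree (with_proj D) v \<le> i" if "v \<in> V" for v
    using that S(3)[OF that] by (simp add: in_degree_def card_image inj_on_def)
  moreover have "out_arcs (with_proj D) v = Pair v ` {w \<in> V. v \<in> S w}" if "v \<in> V" for v
    using that by (auto simp: D_def out_arcs_def)
  then have "out_degree (with_proj D) v \<le> j" if "v \<in> V" for v
    using that S(5)[OF that] by (simp add: out_degree_def card_image inj_on_def)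
  ultimately have "ij_digraph i j D"
    using D by (simp add: ij_digraph_def D_def)
  moreover have "competition_graph D = clique_graph V S"
    unfolding competition_graph_def clique_graph_def D_def by (auto dest: sub(1))
  ultimately show ?thesis
    using ij_competition_graph_competition_graph by metis
qed

text \<open>In-neighbourhoods in \<open>D\<close> are pulled back along the isomorphism to subsets
  of the vertex set of \<open>G\<close>, which turns isomorphism into equality.\<close>

lemma ij_competition_graphE:
  assumes "ij_competition_graph i j (G :: 'a pair_pre_digraph)"
  obtains V S where "ij_cliques i j V S" and "G = clique_graph V S"
proof -
  obtain D :: "'a pair_pre_digraph" and hom where D: "ij_digraph i j D"
    and iso: "pre_digraph.digraph_isomorphism (with_proj G) hom"
    and eq: "with_proj (competition_graph D) = app_iso hom (with_proj G)"
    using assms unfolding ij_competition_graph_def digraph_iso_def by blast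
  interpret D: pair_digraph D
    using D by (simp add: ij_digraph_def)
  interpret G: wf_digraph "with_proj G"
    using iso by (simp add: pre_digraph.digraph_isomorphism_def)
  define h where "h = iso_verts hom"
  define V where "V = pverts G"
  define S where "S w = {u \<in> V. (h u, h w) \<in> parcs D}" for w
  have inj: "inj_on h V" and
    compat: "\<And>a. a \<in> parcs G \<Longrightarrow> h (fst a) = iso_tail hom (iso_arcs hom a)"
    "\<And>a. a \<in> parcs G \<Longrightarrow> h (snd a) = iso_head hom (iso_arcs hom a)"
    using iso by (simp_all add: pre_digraph.digraph_isomorphism_def h_def V_def)
  have verts: "pverts D = h ` V"
    and arcs: "parcs (competition_graph D) = iso_arcs hom ` parcs G"
    and proj: "iso_tail hom = fst" "iso_head hom = snd"
    using arg_cong[OF eq, of verts] arg_cong[OF eq, of arcs]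
      arg_cong[OF eq, of tail] arg_cong[OF eq, of head]
    by (simp_all add: competition_graph_def h_def V_def)
  have hV: "h v \<in> pverts D" if "v \<in> V" for v
    using that verts by simp
  have finV: "finite V"
    using verts inj D.pair_finite_verts finite_imageD by metis
  have S_sub: "S w \<subseteq> V - {w}" for w
    using D.pair_no_loops[of "(h w, h w)"] by (auto simp: S_def)
  have finA: "finite (parcs D)" by (rule D.pair_finite_arcs)
  have S_card: "card (S w) \<le> i" if "w \<in> V" for w
  proof -
    have "card (S w) \<le> card (in_arcs (with_proj D) (h w))"
    proof (rule card_inj_on_le[where f = "\<lambda>u. (h u, h w)"])
      show "inj_on (\<lambda>u. (h u, h w)) (S w)"
        using inj by (auto simp: inj_on_def S_def)
      show "(\<lambda>u. (h u, h w)) ` S w \<subseteq> in_arcs (with_proj D) (h w)"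
        by (auto simp: S_def)
      show "finite (in_arcs (with_proj D) (h w))"
        using finA by (simp add: in_arcs_def)
    qed
    then show ?thesis
      using D hV[OF that] by (auto simp: ij_digraph_def in_degree_def dest: bspec)
  qed
  have S_cover: "card {w \<in> V. v \<in> S w} \<le> j" if "v \<in> V" for v
  proof -
    have "card {w \<in> V. v \<in> S w} \<le> card (out_arcs (with_proj D) (h v))"
    proof (rule card_inj_on_le[where f = "\<lambda>w. (h v, h w)"])
      show "inj_on (\<lambda>w. (h v, h w)) {w \<in> V. v \<in> S w}"
        using inj by (auto simp: inj_on_def)
      show "(\<lambda>w. (h v, h w)) ` {w \<in> V. v \<in> S w} \<subseteq> out_arcs (with_proj D) (h v)"
        by (auto simp: S_def)
      show "finite (out_arcs (with_proj D) (h v))"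
        using finA by (simp add: out_arcs_def)
    qed
    then show ?thesis
      using D hV[OF that] by (auto simp: ij_digraph_def out_degree_def dest: bspec)
  qed
  have wf: "u \<in> V" "v \<in> V" if "(u, v) \<in> parcs G" for u v
    using G.wellformed[of "(u, v)"] that by (auto simp: V_def)
  \<comment> \<open>Tail and head in the target are \<open>fst\<close> and \<open>snd\<close>, so
    the arc map is determined by the vertex map.\<close>
  have arc_image: "iso_arcs hom (u, v) = (h u, h v)" if "(u, v) \<in> parcs G" for u v
    using compat[OF that] by (simp add: proj prod_eq_iff)
  have "(u, v) \<in> parcs G \<longleftrightarrow> u \<in> V \<and> v \<in> V \<and> (h u, h v) \<in> parcs (competition_graph D)" for u v
  proof
    assume "(u, v) \<in> parcs G"
    then show "u \<in> V \<and> v \<in> V \<and> (h u, h v) \<in> parcs (competition_graph D)"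
      using arcs arc_image wf by (metis imageI)
  next
    assume *: "u \<in> V \<and> v \<in> V \<and> (h u, h v) \<in> parcs (competition_graph D)"
    then obtain u' v' where "(u', v') \<in> parcs G" "(h u', h v') = (h u, h v)"
      using arcs arc_image by auto
    then show "(u, v) \<in> parcs G"
      using * inj wf by (metis inj_onD prod.inject)
  qed
  then have "(u, v) \<in> parcs G \<longleftrightarrow> u \<noteq> v \<and> (\<exists>w \<in> V. u \<in> S w \<and> v \<in> S w)" for u v
    using inj_on_eq_iff[OF inj, of u v] by (auto simp: competition_graph_def S_def verts)
  then have "G = clique_graph V S"
    unfolding clique_graph_def V_def
    by (intro pair_pre_digraph.equality) auto
  moreover have "ij_cliques i j V S"
    using finV S_sub S_card S_cover by (simp add: ij_cliques_def)
  ultimately show thesis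
    using that by blast
qed

lemma clique_graph_in_ij_family: "ij_cliques i j V S \<Longrightarrow> clique_graph V S \<in> ij_family i j"
  by (simp add: ij_family_def ij_competition_graph_clique_graph)

lemma ij_familyE:
  assumes "G \<in> ij_family i j"
  obtains V S where "ij_cliques i j V S" and "G = clique_graph V S"
  using assms by (auto simp: ij_family_def elim: ij_competition_graphE)

lemma ij_family_mono:
  assumes "k \<le> i" "l \<le> j"
  shows "ij_family k l \<subseteq> ij_family i j"
proof
  fix G assume "G \<in> ij_family k l"
  then obtain V S where "ij_cliques k l V S" and G: "G = clique_graph V S"
    by (rule ij_familyE)
  then have "ij_cliques i j V S"
    using assms unfolding ij_cliques_def by (meson le_trans)
  then show "G \<in> ij_family i j"
    unfolding G by (rule clique_graph_in_ij_family)
qed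

text \<open>Sets with at most one element produce no edges, so these graphs are edgeless and empty
  sets represent them for any \<open>i\<close> and \<open>j\<close>.\<close>

lemma ij_family_1_subset: "ij_family 1 l \<subseteq> ij_family i j"
proof
  fix G assume "G \<in> ij_family 1 l"
  then obtain V S where S: "ij_cliques 1 l V S" and G: "G = clique_graph V S"
    by (rule ij_familyE)
  have "u = v" if "w \<in> V" "u \<in> S w" "v \<in> S w" for u v w
    using ij_cliquesD(3,4)[OF S that(1)] that by (auto simp: card_le_Suc0_iff_eq)
  then have "G = clique_graph V (\<lambda>_. {})"
    unfolding G clique_graph_def by auto
  moreover have "ij_cliques i j V (\<lambda>_. {})"
    using ij_cliquesD(1)[OF S] by (simp add: ij_cliques_def)
  ultimately show "G \<in> ij_family i j"
    using clique_graph_in_ij_family by metis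
qed

subsection \<open>Bounds for competition graphs\<close>

text \<open>Each neighbour of \<open>v\<close> shares with it one of the at most \<open>j\<close>
  sets containing \<open>v\<close>, and such a set has at most \<open>i - 1\<close> other
  elements.\<close>

lemma card_neighbours_le:
  assumes "G \<in> ij_family i j" "v \<in> pverts G"
  shows "card {u. (v, u) \<in> parcs G} \<le> (i - 1) * j"
proof -
  obtain V S where S: "ij_cliques i j V S" and G: "G = clique_graph V S"
    using assms(1) by (rule ij_familyE)
  note S = ij_cliquesD[OF S]
  have v: "v \<in> V" using assms(2) by (simp add: G clique_graph_def)
  let ?W = "{w \<in> V. v \<in> S w}"
  have "card {u. (v, u) \<in> parcs G} \<le> card (\<Union>w \<in> ?W. S w - {v})"
    using S(1,4) by (intro card_mono) (auto simp: G clique_graph_def)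
  also have "\<dots> \<le> (\<Sum>w \<in> ?W. card (S w - {v}))"
    using S(1) by (intro card_UN_le) auto
  also have "\<dots> \<le> (\<Sum>w \<in> ?W. i - 1)"
    using S(3) by (intro sum_mono) (auto simp: card_Diff_singleton intro: diff_le_mono)
  also have "\<dots> \<le> (i - 1) * j"
    using S(5)[OF v] by (simp add: mult.commute)
  finally show ?thesis .
qed

text \<open>A set containing \<open>v\<close> and two elements of \<open>I\<close> would make these
  adjacent. So the elements of \<open>I\<close> need distinct sets through \<open>v\<close>.\<close>

lemma card_independent_neighbours_le:
  assumes "G \<in> ij_family i j" "v \<in> pverts G"
    and adj: "\<And>u. u \<in> I \<Longrightarrow> (v, u) \<in> parcs G"
    and indep: "\<And>u u'. u \<in> I \<Longrightarrow> u' \<in> I \<Longrightarrow> (u, u') \<notin> parcs G"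
  shows "card I \<le> j"
proof -
  obtain V S where S: "ij_cliques i j V S" and G: "G = clique_graph V S"
    using assms(1) by (rule ij_familyE)
  note S = ij_cliquesD[OF S]
  have v: "v \<in> V" using assms(2) by (simp add: G clique_graph_def)
  have "\<forall>u \<in> I. \<exists>w. w \<in> V \<and> v \<in> S w \<and> u \<in> S w"
    using adj by (auto simp: G clique_graph_def)
  then obtain f where f: "\<forall>u \<in> I. f u \<in> V \<and> v \<in> S (f u) \<and> u \<in> S (f u)"
    by metis
  have "inj_on f I"
  proof (rule inj_onI, rule ccontr)
    fix u u' assume *: "u \<in> I" "u' \<in> I" "f u = f u'" "u \<noteq> u'"
    then have "f u \<in> V" "u \<in> S (f u)" "u' \<in> S (f u)"
      using f by metis+
    then show False
      using * indep[of u u'] by (auto simp: G clique_graph_def)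
  qed
  then have "card I \<le> card {w \<in> V. v \<in> S w}"
    using f S(1) by (intro card_inj_on_le[of f]) auto
  then show ?thesis
    using S(5)[OF v] by simp
qed

lemma card_off_diagonal:
  assumes "finite A"
  shows "card (SIGMA u:A. A - {u}) = card A * (card A - 1)"
  using assms by (simp add: card_Diff_singleton)

text \<open>Each vertex contributes one clique with at most \<open>i * (i - 1)\<close> ordered
  pairs. The bound does not involve \<open>j\<close>, so it separates families whatever their
  outdegree bounds are.\<close>

lemma card_parcs_le:
  assumes "G \<in> ij_family i j"
  shows "finite (parcs G)" and "card (parcs G) \<le> card (pverts G) * (i * (i - 1))"
proof -
  obtain V S where S: "ij_cliques i j V S" and G: "G = clique_graph V S"
    using assms by (rule ij_familyE)
  note S = ij_cliquesD[OF S]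
  let ?E = "\<lambda>w. SIGMA u:S w. S w - {u}"
  have parcs: "parcs G = (\<Union>w \<in> V. ?E w)"
    by (auto simp: G clique_graph_def)
  show "finite (parcs G)"
    unfolding parcs using S(1,4) by auto
  have "card (parcs G) \<le> (\<Sum>w \<in> V. card (?E w))"
    unfolding parcs using S(1) by (rule card_UN_le)
  also have "\<dots> \<le> (\<Sum>w \<in> V. i * (i - 1))"
  proof (rule sum_mono)
    fix w assume "w \<in> V"
    then show "card (?E w) \<le> i * (i - 1)"
      using S(3)[of w] card_off_diagonal[OF S(4)] by (metis diff_le_mono mult_le_mono)
  qed
  finally show "card (parcs G) \<le> card (pverts G) * (i * (i - 1))"
    by (simp add: G clique_graph_def)
qed

subsection \<open>Windmills and cliques\<close>

text \<open>
  The centre is \<open>0\<close>, the other vertices of the blades are \<open>1, \<dots>, c - 1\<close>, and the \<open>j\<close> isolated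
  vertices from \<open>c\<close> on serve as common out-neighbours of the blades.
\<close>

definition windmill :: "nat \<Rightarrow> nat \<Rightarrow> nat pair_pre_digraph" where
  "windmill i j =
     (let c = j * (i - 1) + 1 in
      clique_graph {..<c + j}
        (\<lambda>w. if w < c then {} else insert 0 {v \<in> {1..<c}. (v - 1) div (i - 1) = w - c}))"

lemma windmill_in_ij_family:
  assumes "i \<ge> 2"
  shows "windmill i j \<in> ij_family i j"
proof -
  define c where "c = j * (i - 1) + 1"
  let ?V = "{..<c + j}"
  define S :: "nat \<Rightarrow> nat set" where
    "S w = (if w < c then {} else insert 0 {v \<in> {1..<c}. (v - 1) div (i - 1) = w - c})" for w
  have "card (S w) \<le> i" for w
  proof (cases "w < c")
    case False
    \<comment> \<open>Without its centre, a blade is a block of consecutive numbers, indexed by the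
      remainder of \<open>v - 1\<close> modulo \<open>i - 1\<close>.\<close>
    have "{v \<in> {1..<c}. (v - 1) div (i - 1) = w - c}
        \<subseteq> (\<lambda>s. 1 + (w - c) * (i - 1) + s) ` {..<i - 1}"
    proof
      fix v assume "v \<in> {v \<in> {1..<c}. (v - 1) div (i - 1) = w - c}"
      then have v: "1 \<le> v" "(v - 1) div (i - 1) = w - c"
        by auto
      have "(w - c) * (i - 1) + (v - 1) mod (i - 1) = v - 1"
        using div_mult_mod_eq[of "v - 1" "i - 1"] unfolding v(2) .
      then have "v = 1 + (w - c) * (i - 1) + (v - 1) mod (i - 1)"
        using v(1) by linarith
      moreover have "(v - 1) mod (i - 1) < i - 1"
        using assms by simp
      ultimately show "v \<in> (\<lambda>s. 1 + (w - c) * (i - 1) + s) ` {..<i - 1}"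
        by blast
    qed
    then have "card {v \<in> {1..<c}. (v - 1) div (i - 1) = w - c} \<le> i - 1"
      using surj_card_le[of "{..<i - 1}"] by simp
    then show ?thesis
      using False assms by (simp add: S_def)
  qed (simp add: S_def)
  moreover have "card {w \<in> ?V. v \<in> S w} \<le> j" for v
  proof -
    \<comment> \<open>Only the \<open>j\<close> vertices from \<open>c\<close> on carry a non-empty
      set, so even the centre is covered at most \<open>j\<close> times.\<close>
    have "{w \<in> ?V. v \<in> S w} \<subseteq> {c..<c + j}"
      by (auto simp: S_def split: if_splits)
    then have "card {w \<in> ?V. v \<in> S w} \<le> card {c..<c + j}"
      by (intro card_mono) auto
    then show ?thesis by simp
  qed
  moreover have "S w \<subseteq> ?V - {w}" for w
    by (auto simp: S_def c_def)
  ultimately have "ij_cliques i j ?V S"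
    by (simp add: ij_cliques_def)
  moreover have "windmill i j = clique_graph ?V S"
    unfolding windmill_def Let_def S_def[abs_def] c_def by (rule refl)
  ultimately show ?thesis
    using clique_graph_in_ij_family by metis
qed

lemma windmill_verts: "0 \<in> pverts (windmill i j)"
  by (simp add: windmill_def Let_def clique_graph_def)

lemma windmill_centre:
  assumes "i \<ge> 2" "v \<in> {1..j * (i - 1)}"
  shows "(0, v) \<in> parcs (windmill i j)"
proof -
  \<comment> \<open>\<open>?t\<close> numbers the blade of \<open>v\<close>, so
    \<open>?c + ?t\<close> is the common out-neighbour of \<open>0\<close> and
    \<open>v\<close>.\<close>
  let ?c = "j * (i - 1) + 1" and ?t = "(v - 1) div (i - 1)"
  have "?t < j"
    using assms by (intro div_less_iff_less_mult[THEN iffD2]) auto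
  then show ?thesis
    using assms
    by (auto simp: windmill_def Let_def clique_graph_def intro!: bexI[of _ "?c + ?t"])
qed

lemma windmill_not_in_ij_family:
  assumes "i \<ge> 2" "(k - 1) * l < (i - 1) * j"
  shows "windmill i j \<notin> ij_family k l"
proof
  assume W: "windmill i j \<in> ij_family k l"
  have "finite {u. (0, u) \<in> parcs (windmill i j)}"
    using finite_imageI[OF card_parcs_le(1)[OF W], of snd] by (rule rev_finite_subset) force
  then have "card {1..j * (i - 1)} \<le> card {u. (0, u) \<in> parcs (windmill i j)}"
    using windmill_centre[OF assms(1)] by (intro card_mono) auto
  also have "\<dots> \<le> (k - 1) * l"
    using W windmill_verts by (rule card_neighbours_le)
  finally show False
    using assms(2) by (simp add: mult.commute)
qed

text \<open>Each blade of \<open>windmill 2 l\<close> has a single vertex besides the centre, so the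
  centre has \<open>l\<close> pairwise non-adjacent neighbours.\<close>

lemma star_not_in_ij_family:
  assumes "j < l"
  shows "windmill 2 l \<notin> ij_family i j"
proof
  assume "windmill 2 l \<in> ij_family i j"
  then have "card {1..l} \<le> j"
  proof (rule card_independent_neighbours_le[OF _ windmill_verts])
    show "(0, u) \<in> parcs (windmill 2 l)" if "u \<in> {1..l}" for u
      using windmill_centre[of 2 u l] that by simp
    show "(u, u') \<notin> parcs (windmill 2 l)" if "u \<in> {1..l}" "u' \<in> {1..l}" for u u'
      using that by (auto simp: windmill_def Let_def clique_graph_def split: if_splits)
  qed
  then show False using assms by simp
qed

text \<open>The vertex \<open>i\<close> is isolated and serves as the common out-neighbour of a
  clique on \<open>{..<i}\<close>. Counting arcs would force
  \<open>i * (i - 1) \<le> (i + 1) * (k * (k - 1))\<close>.\<close>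

lemma large_clique_separates:
  assumes "j > 0" "i > k\<^sup>2 - k + 1"
  shows "\<not> ij_family i j \<subseteq> ij_family k l"
proof
  assume sub: "ij_family i j \<subseteq> ij_family k l"
  let ?V = "{..i}"
  let ?S = "\<lambda>w. if w = i then {..<i} else {}"
  let ?G = "clique_graph ?V ?S"
  have "card {w. w \<le> i \<and> v \<in> ?S w} \<le> j" for v
  proof -
    have "card {w. w \<le> i \<and> v \<in> ?S w} \<le> card {i}"
      by (intro card_mono) (auto split: if_splits)
    then show ?thesis using assms(1) by simp
  qed
  then have "ij_cliques i j ?V ?S"
    by (auto simp: ij_cliques_def)
  then have G: "?G \<in> ij_family k l"
    using sub clique_graph_in_ij_family by blast
  have "parcs ?G = (SIGMA u:{..<i}. {..<i} - {u})"
    by (auto simp: clique_graph_def split: if_splits)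
  then have "i * (i - 1) = card (parcs ?G)"
    by (simp only: card_off_diagonal finite_lessThan card_lessThan)
  also have "\<dots> \<le> (i + 1) * (k * (k - 1))"
    using card_parcs_le(2)[OF G] by (simp add: clique_graph_def)
  finally have le: "i * (i - 1) \<le> (i + 1) * (k * (k - 1))" .
  define m where "m = k * (k - 1)"
  have "k\<^sup>2 - k = m"
    by (simp add: m_def power2_eq_square diff_mult_distrib2)
  then have m: "m + 1 \<le> i - 1" "m < i" using assms(2) by simp_all
  have "(i + 1) * m < i * (m + 1)" using m(2) by simp
  also have "\<dots> \<le> i * (i - 1)" using m(1) by (rule mult_le_mono2)
  finally show False using le by (simp add: m_def)
qed

subsection \<open>A partial linear space\<close>

text \<open>
  The points are the pairs \<open>(g, y)\<close> with \<open>g \<le> k\<close> and \<open>y < k\<^sup>3 + k\<^sup>2\<close>, and the lines are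
  \<open>y = a + b g\<close> with \<open>a < k\<^sup>3\<close> and \<open>b < k\<close>. The common out-neighbour of the line \<open>(a, b)\<close> is
  the point \<open>(b + 1, a + b (b + 1) + 1)\<close> just above it.
\<close>

lemma partial_linear_space_separates:
  fixes k :: nat
  assumes "k \<ge> 2"
  shows "\<not> ij_family (k + 1) k \<subseteq> ij_family k l"
proof
  assume sub: "ij_family (k + 1) k \<subseteq> ij_family k l"
  define N where "N = k ^ 3 + k\<^sup>2"
  define V where "V = prod_encode ` ({..k} \<times> {..<N})"
  define line where "line a b = (\<lambda>g. prod_encode (g, a + b * g)) ` {..k}" for a b
  define out where "out a b = prod_encode (b + 1, a + b * (b + 1) + 1)" for a b
  define S where
    "S w = {v. \<exists>a b. a < k ^ 3 \<and> b < k \<and> w = out a b \<and> v \<in> line a b}" for w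
  \<comment> \<open>The column of \<open>out a b\<close> determines \<open>b\<close> and then its
    height determines \<open>a\<close>, so each point serves at most one line.\<close>
  have out_eq: "out a b = out a' b' \<longleftrightarrow> a = a' \<and> b = b'" for a b a' b'
    by (auto simp: out_def)
  \<comment> \<open>Lines and their out-neighbours rise less than \<open>k\<^sup>2\<close> above
    \<open>a < k ^ 3\<close>, hence stay below height \<open>N\<close>.\<close>
  have bound: "b * g + 1 < k\<^sup>2" if "b < k" "g \<le> k" for b g
  proof -
    have "b * g \<le> (k - 1) * k"
      using that by (intro mult_le_mono) auto
    also have "\<dots> = k\<^sup>2 - k"
      by (simp add: power2_eq_square diff_mult_distrib)
    finally show ?thesis
      using assms power2_nat_le_imp_le[of k "k\<^sup>2"] self_le_power[of k 2] by simp
  qed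
  have S_out: "S (out a b) = line a b" if "a < k ^ 3" "b < k" for a b
    using that by (auto simp: S_def out_eq)
  have out_V: "out a b \<in> V" if "a < k ^ 3" "b < k" for a b
    using bound[of b "b + 1"] that by (auto simp: out_def V_def N_def)
  have line_V: "line a b \<subseteq> V - {out a b}" if "a < k ^ 3" "b < k" for a b
    using bound[of b] that by (fastforce simp: line_def out_def V_def N_def)
  have card_V: "card V = (k + 1) * N"
    unfolding V_def by (simp add: card_image inj_prod_encode card_cartesian_product)
  have "S w \<subseteq> V - {w}" for w
    using line_V by (fastforce simp: S_def)
  moreover have "card (S w) \<le> k + 1" for w
  proof (cases "\<exists>a b. a < k ^ 3 \<and> b < k \<and> w = out a b")
    case True
    then show ?thesis
      using S_out card_image_le[of "{..k}"] by (auto simp: line_def)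
  next
    case False
    then have "S w = {}" by (auto simp: S_def)
    then show ?thesis by simp
  qed
  moreover have "card {w \<in> V. v \<in> S w} \<le> k" for v
  proof -
    obtain g y where v: "v = prod_encode (g, y)"
      by (metis prod_decode_inverse surj_pair)
    \<comment> \<open>Through a given point there is at most one line of each slope
      \<open>b\<close>, namely the one with \<open>a = y - b * g\<close>.\<close>
    have "{w \<in> V. v \<in> S w} \<subseteq> (\<lambda>b. out (y - b * g) b) ` {..<k}"
    proof
      fix w assume "w \<in> {w \<in> V. v \<in> S w}"
      then obtain a b where "b < k" "w = out a b" "y = a + b * g"
        by (auto simp: S_def v line_def)
      then show "w \<in> (\<lambda>b. out (y - b * g) b) ` {..<k}"
        by (intro image_eqI[of _ _ b]) auto
    qed
    then show ?thesis
      using surj_card_le[of "{..<k}"] by simp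
  qed
  ultimately have "ij_cliques (k + 1) k V S"
    by (simp add: ij_cliques_def V_def)
  then have G: "clique_graph V S \<in> ij_family k l" (is "?G \<in> _")
    using sub clique_graph_in_ij_family by blast
  let ?P = "SIGMA u:{..k}. {..k} - {u}"
  \<comment> \<open>\<open>?f\<close> sends a line and an ordered pair of distinct columns to the
    arc between the two points of the line in these columns.\<close>
  let ?f = "\<lambda>((a, b), (g, g')). (prod_encode (g, a + b * g), prod_encode (g', a + b * g'))"
  have inj: "inj_on ?f (({..<k ^ 3} \<times> {..<k}) \<times> ?P)"
  proof -
    \<comment> \<open>Two lines meeting in two columns coincide. The computation moves to the
      integers to subtract freely.\<close>
    have "a = a' \<and> b = b'" if "g \<noteq> g'" "a + b * g = a' + b' * g" "a + b * g' = a' + b' * g'"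
      for a b a' b' g g' :: nat
    proof -
      have "int a + int b * int g = int a' + int b' * int g"
        "int a + int b * int g' = int a' + int b' * int g'"
        using that(2,3) by (metis of_nat_add of_nat_mult)+
      then have "(int b - int b') * (int g - int g') = 0"
        by (simp add: algebra_simps)
      then have "b = b'" using that(1) by simp
      then show ?thesis using that(2) by simp
    qed
    note lines = this
    show ?thesis
    proof (rule inj_onI)
      fix p q
      assume p: "p \<in> ({..<k ^ 3} \<times> {..<k}) \<times> ?P" and eq: "?f p = ?f q"
      obtain a b g g' a' b' h h' where pq: "p = ((a, b), (g, g'))" "q = ((a', b'), (h, h'))"
        by (metis surj_pair)
      have "g = h" "g' = h'" "a + b * g = a' + b' * g" "a + b * g' = a' + b' * g'"
        using eq by (auto simp: pq)
      moreover have "g \<noteq> g'"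
        using p by (auto simp: pq)
      ultimately show "p = q"
        using lines[of g g' a b a' b'] by (simp add: pq)
    qed
  qed
  have "?f ` (({..<k ^ 3} \<times> {..<k}) \<times> ?P) \<subseteq> parcs ?G"
  proof (rule image_subsetI)
    fix p assume p: "p \<in> ({..<k ^ 3} \<times> {..<k}) \<times> ?P"
    obtain a b g g' where p_eq: "p = ((a, b), (g, g'))"
      by (metis surj_pair)
    have *: "a < k ^ 3" "b < k" "g \<le> k" "g' \<le> k" "g' \<noteq> g"
      using p by (auto simp: p_eq)
    then have "{prod_encode (g, a + b * g), prod_encode (g', a + b * g')} \<subseteq> S (out a b)"
      using S_out by (auto simp: line_def)
    then show "?f p \<in> parcs ?G"
      using * out_V[of a b] by (auto simp: clique_graph_def p_eq)
  qed
  then have "card (({..<k ^ 3} \<times> {..<k}) \<times> ?P) \<le> card (parcs ?G)"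
    using inj card_parcs_le(1)[OF G] by (intro card_inj_on_le)
  moreover have "card ?P = (k + 1) * k"
    by (simp only: card_off_diagonal finite_atMost card_atMost) simp
  ultimately have "k ^ 3 * k * ((k + 1) * k) \<le> card (parcs ?G)"
    by (simp only: card_cartesian_product card_lessThan)
  also have "\<dots> \<le> (k + 1) * N * (k * (k - 1))"
    using card_parcs_le(2)[OF G] card_V by (simp add: clique_graph_def)
  finally have "((k + 1) * k) * (k ^ 3 * k) \<le> ((k + 1) * k) * (N * (k - 1))"
    by (simp only: mult_ac)
  then have le: "k ^ 3 * k \<le> N * (k - 1)"
    using assms by (simp only: mult_le_cancel1) simp
  \<comment> \<open>The right-hand side of \<open>le\<close> is
    \<open>(k ^ 3 + k ^ 2) * (k - 1) = k ^ 4 - k ^ 2\<close>, which is less than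
    \<open>k ^ 4\<close>. Writing \<open>k\<close> as a successor removes the truncated
    subtraction.\<close>
  obtain m where "k = Suc m" using assms by (cases k) auto
  then show False
    using le by (simp add: N_def power2_eq_square power3_eq_cube algebra_simps)
qed

section \<open>Comparison of the families\<close>

theorem theorem3p1:
  fixes i j k l :: nat
  assumes "i > 0" "j > 0" "k > 0" "l > 0"
    and "(i, j) \<noteq> (k, l)"
    and "i \<ge> k"
  shows
    "(i = k \<and> j > l \<longrightarrow>
        (k = 1 \<longrightarrow> ij_family i j = ij_family k l) \<and>
        (k > 1 \<longrightarrow> ij_family k l \<subset> ij_family i j)) \<and>
     (i > k \<and> j > l \<longrightarrow> ij_family k l \<subset> ij_family i j) \<and>
     (i > k \<and> j = l \<longrightarrow> ij_family k l \<subset> ij_family i j) \<and>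
     (i > k \<and> j < l \<longrightarrow>
        ((k = 1 \<longrightarrow> ij_family k l \<subset> ij_family i j) \<and>
         (k > 1 \<longrightarrow> \<not> ij_family k l \<subseteq> ij_family i j)) \<and>
        (i > k\<^sup>2 - k + 1 \<or> (i - 1) * j > (k - 1) * l \<or> (j \<ge> k \<and> k \<ge> 2) \<longrightarrow>
         \<not> ij_family i j \<subseteq> ij_family k l))"
proof -
  have windmill: "\<not> ij_family i j \<subseteq> ij_family k l" if "(k - 1) * l < (i - 1) * j"
  proof -
    have "i \<ge> 2" using that by (cases "i \<ge> 2") auto
    then show ?thesis
      using windmill_in_ij_family windmill_not_in_ij_family that by blast
  qed
  have proper: "ij_family k l \<subset> ij_family i j"
    if "(k - 1) * l < (i - 1) * j" "k = 1 \<or> l \<le> j"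
    using windmill[OF that(1)] that(2) ij_family_1_subset[of l i j]
      ij_family_mono[OF assms(6), of l j]
    by auto
  have "(k - 1) * l < (i - 1) * j" if "i = k" "j > l" "k > 1"
    using that by simp
  moreover have "(k - 1) * l < (i - 1) * j" if "i > k" "j \<ge> l"
    using that assms by (intro mult_less_le_imp_less) auto
  moreover have "(k - 1) * l < (i - 1) * j" if "i > k" "k = 1"
    using that assms(2) by simp
  moreover have "ij_family i j = ij_family k l" if "i = k" "k = 1"
    using that ij_family_1_subset by blast
  \<comment> \<open>The star \<open>windmill 2 l\<close> separates: it lies in
    \<open>ij_family k l\<close> by monotonicity, as \<open>k \<ge> 2\<close>.\<close>
  moreover have "\<not> ij_family k l \<subseteq> ij_family i j" if "k > 1" "j < l"
    using that windmill_in_ij_family[of 2 l] star_not_in_ij_family[of j l i]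
      ij_family_mono[of 2 k l l] by auto
  moreover have "\<not> ij_family i j \<subseteq> ij_family k l" if "i > k\<^sup>2 - k + 1"
    using assms(2) that by (rule large_clique_separates)
  \<comment> \<open>By monotonicity \<open>ij_family (k + 1) k\<close> is contained in
    \<open>ij_family i j\<close>, so its separation from \<open>ij_family k l\<close>
    suffices.\<close>
  moreover have "\<not> ij_family i j \<subseteq> ij_family k l" if "i > k" "j \<ge> k" "k \<ge> 2"
    using partial_linear_space_separates[OF that(3), of l] ij_family_mono[of "k + 1" i k j] that
    by auto
  ultimately show ?thesis
    using windmill proper by (auto simp del: One_nat_def)
qed

end
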